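(* Let $\mathcal{T}\in\mathbb{R}^{I\times J\times K}$, $\mathcal{T}\ne0$, and $1\le R\le\min\{J,K\}$. Let $\mathbf{M}=\bar{\mathbf{V}}\mathbf{S}\bar{\mathbf{V}}^T$ with $\bar{\mathbf{V}}\in\mathbb{R}^{JK\times JK}$ orthogonal with columns $\bar{\mathbf{v}}_i$ and $\mathbf{S}=\mathrm{diag}(\lambda_1,\dots,\lambda_{JK})$, and let $\bar{\mathbf{V}}_i\in\mathbb{R}^{J\times K}$ be the matricization of $\bar{\mathbf{v}}_i$. Define the centroid matrix $$\bar{\mathbf{V}}^{C}:=\frac{\sum_{i=1}^{JK}\lambda_i\bar{\mathbf{V}}_i}{\sum_{i=1}^{JK}\lambda_i},$$ and let $\mathbf{y}_k$, $\mathbf{z}_k$ be the left and right singular vectors in the singular value decomposition of $\bar{\mathbf{V}}^C$, ordered by nonincreasing singular values $\sigma_k(\bar{\mathbf{V}}^C)$. Then $$\mathbf{B}_C=(\mathbf{y}_1\ \ldots\ \mathbf{y}_R),\qquad \mathbf{C}_C=(\mathbf{z}_1\ \ldots\ \mathbf{z}_R)$$ is a minimizer of $$\mathfrak{L}(\mathbf{B},\mathbf{C}):=\inf_{\mathbf{X}\in\mathrm{KR}(\mathbf{B},\mathbf{C})}\frac12\sum_{i=1}^{JK}\lambda_i\|\bar{\mathbf{V}}_i-\mathbf{X}\|_F^2$$ over $\mathbf{B}\in\mathbb{R}^{J\times R}$, $\mathbf{C}\in\mathbb{R}^{K\times R}$. Moreover, $$\inf_{\mathbf{B},\mathbf{C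}}\mathfrak{L}(\mathbf{B},\mathbf{C})=\frac12\left[\left(1-\|\bar{\mathbf{V}}^C\|_F^2\right)\left(\sum_{i=1}^{JK}\lambda_i\right)+\left(\sum_{i=1}^{JK}\lambda_i\right)\left(\sum_{k=R+1}^{\min\{J,K\}}\sigma_k(\bar{\mathbf{V}}^C)^2\right)\right].$$
   Context: $I,J,K$ are positive integers. $\mathbf{M}\in\mathbb{R}^{JK\times JK}$ is the symmetric matrix whose entry at row $\alpha+(\beta-1)J$ and column $\gamma+(\delta-1)J$ is $\sum_{i=1}^I\mathcal{T}_{i\alpha\beta}\mathcal{T}_{i\gamma\delta}$, for $1\le\alpha,\gamma\le J$, $1\le\beta,\delta\le K$. The matricization of $\mathbf{v}\in\mathbb{R}^{JK}$ is the $J\times K$ matrix whose $(j,k)$ entry is the entry of $\mathbf{v}$ at position $j+(k-1)J$. The Khatri-Rao range is $\mathrm{KR}(\mathbf{B},\mathbf{C})=\{\sum_{r=1}^R\mu_r\,\mathbf{b}_r\circ\mathbf{c}_r\in\mathbb{R}^{J\times K}:\mu_r\in\mathbb{R}\}$, where $\mathbf{b}_r,\mathbf{c}_r$ are the columns of $\mathbf{B},\mathbf{C}$ and $(\mathbf{b}\circ\mathbf{c})_{jk}=b_jc_k$. $\|\cdot\|_F$ is the Frobenius norm. An empty sum is $0$. *)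

theory Defs
  imports Complex_Main "Jordan_Normal_Form.Matrix"
begin

text \<open>
  Vectors and matrices are those of Jordan_Normal_Form, so all indices start at 0; the
  1-based linear index \<open>j + (k - 1) J\<close> becomes \<open>j + k * J\<close>. A tensor in
  \<open>\<real>^(I \<times> J \<times> K)\<close> is a function \<open>nat \<Rightarrow> nat \<Rightarrow> nat \<Rightarrow> real\<close> of which only the values at
  \<open>i < I\<close>, \<open>j < J\<close>, \<open>k < K\<close> are used.
\<close>

text \<open>Position \<open>p = \<alpha> + \<beta> * J\<close> with \<open>\<alpha> < J\<close> decodes to \<open>\<alpha> = p mod J\<close>, \<open>\<beta> = p div J\<close>.\<close>

definition tensor_gram :: "nat \<Rightarrow> nat \<Rightarrow> nat \<Rightarrow> (nat \<Rightarrow> nat \<Rightarrow> nat \<Rightarrow> real) \<Rightarrow> real mat" where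
  "tensor_gram I J K T = mat (J * K) (J * K)
     (\<lambda>(p, q). \<Sum>i<I. T i (p mod J) (p div J) * T i (q mod J) (q div J))"

definition matricize :: "nat \<Rightarrow> nat \<Rightarrow> real vec \<Rightarrow> real mat" where
  "matricize J K v = mat J K (\<lambda>(j, k). v $ (j + k * J))"

definition frobenius_norm :: "real mat \<Rightarrow> real" where
  "frobenius_norm A = sqrt (\<Sum>j<dim_row A. \<Sum>k<dim_col A. (A $$ (j, k))\<^sup>2)"

definition outer_product :: "real vec \<Rightarrow> real vec \<Rightarrow> real mat" where
  "outer_product b c = mat (dim_vec b) (dim_vec c) (\<lambda>(j, k). b $ j * c $ k)"

text \<open>Matrices of non-fixed dimension do not form an additive monoid type, hence the
  entrywise sum. The common number of columns \<open>R\<close> is read off \<open>B\<close>.\<close>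

definition khatri_rao_range :: "real mat \<Rightarrow> real mat \<Rightarrow> real mat set" where
  "khatri_rao_range B C =
     {mat (dim_row B) (dim_row C)
        (\<lambda>(j, k). \<Sum>r<dim_col B. \<mu> r * outer_product (col B r) (col C r) $$ (j, k)) | \<mu> :: nat \<Rightarrow> real. True}"

text \<open>The predicate \<open>orthogonal_mat\<close> of Jordan_Normal_Form does not normalise the columns.\<close>

definition real_orthogonal :: "nat \<Rightarrow> real mat \<Rightarrow> bool" where
  "real_orthogonal n Q \<longleftrightarrow> Q \<in> carrier_mat n n \<and> Q\<^sup>T * Q = 1\<^sub>m n \<and> Q * Q\<^sup>T = 1\<^sub>m n"

text \<open>\<open>A = Y \<Sigma> Z\<^sup>T\<close> is a (full) singular value decomposition of the \<open>J \<times> K\<close> matrix \<open>A\<close>, where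
  \<open>\<Sigma>\<close> is \<open>J \<times> K\<close> with diagonal entries \<open>\<sigma> 0 \<ge> \<sigma> 1 \<ge> \<dots> \<ge> 0\<close>; the columns of \<open>Y\<close> and \<open>Z\<close> are
  the left and right singular vectors.\<close>

definition is_svd ::
  "nat \<Rightarrow> nat \<Rightarrow> real mat \<Rightarrow> real mat \<Rightarrow> (nat \<Rightarrow> real) \<Rightarrow> real mat \<Rightarrow> bool" where
  "is_svd J K A Y \<sigma> Z \<longleftrightarrow>
     real_orthogonal J Y \<and> real_orthogonal K Z \<and>
     (\<forall>k < min J K. 0 \<le> \<sigma> k) \<and>
     (\<forall>k l. k \<le> l \<and> l < min J K \<longrightarrow> \<sigma> l \<le> \<sigma> k) \<and>
     A = Y * mat J K (\<lambda>(j, k). if j = k then \<sigma> j else 0) * Z\<^sup>T"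

definition centroid :: "nat \<Rightarrow> nat \<Rightarrow> (nat \<Rightarrow> real) \<Rightarrow> real mat \<Rightarrow> real mat" where
  "centroid J K lam V = mat J K
     (\<lambda>(j, k). (\<Sum>i<J * K. lam i * matricize J K (col V i) $$ (j, k)) / (\<Sum>i<J * K. lam i))"

text \<open>The infimum is over a nonempty set of reals. It is bounded below by 0 when all \<open>lam i\<close>
  are nonnegative, as they are for the eigenvalues of the positive semidefinite
  \<open>tensor_gram I J K T\<close>.\<close>

definition kr_loss ::
  "nat \<Rightarrow> nat \<Rightarrow> (nat \<Rightarrow> real) \<Rightarrow> real mat \<Rightarrow> real mat \<Rightarrow> real mat \<Rightarrow> real" where
  "kr_loss J K lam V B C =
     (INF X \<in> khatri_rao_range B C.
        1 / 2 * (\<Sum>i<J * K. lam i * (frobenius_norm (matricize J K (col V i) - X))\<^sup>2))"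

definition first_cols :: "nat \<Rightarrow> real mat \<Rightarrow> real mat" where
  "first_cols R A = mat_of_cols (dim_row A) (map (col A) [0..<R])"

end

theory Submission
  imports Defs
begin

text \<open>
  Write \<open>\<Lambda> = \<Sum>\<^sub>i \<lambda>\<^sub>i\<close> and let \<open>A\<close> be the centroid. The matricized eigenvectors have Frobenius
  norm \<open>1\<close>, so completing the square gives, for every \<open>J \<times> K\<close> matrix \<open>X\<close>,
  \<open>\<Sum>\<^sub>i \<lambda>\<^sub>i \<parallel>V\<^sub>i - X\<parallel>\<^sup>2 = \<Lambda> (1 - \<parallel>A\<parallel>\<^sup>2) + \<Lambda> \<parallel>A - X\<parallel>\<^sup>2\<close> (\<open>weighted_loss_eq\<close>). If \<open>G\<close> is the
  \<open>I \<times> JK\<close> unfolding of the tensor, then \<open>tensor_gram = G\<^sup>T G\<close>, whence \<open>\<lambda>\<^sub>i\<close> is the squared norm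
  of the \<open>i\<close>-th column of \<open>G V\<close> and \<open>\<Lambda> = \<parallel>G\<parallel>\<^sup>2 > 0\<close>. So the problem is to approximate \<open>A\<close> by an
  element of a Khatri-Rao range, that is, by a matrix of rank at most \<open>R\<close>, and
  the claim becomes the Eckart-Young theorem for \<open>A\<close>.

  For its lower bound, orthogonal invariance replaces \<open>A\<close> by its diagonal matrix of singular
  values. If \<open>w\<^sub>0, \<dots>, w\<^sub>R\<^sub>-\<^sub>1\<close> is an orthonormal system, padded with zeros, whose span
  contains the columns of the approximant, then the \<open>k\<close>-th column \<open>\<sigma>\<^sub>k e\<^sub>k\<close> is at squared
  distance at least \<open>\<sigma>\<^sub>k\<^sup>2 (1 - p\<^sub>k)\<close> from that span, where \<open>p\<^sub>k = \<Sum>\<^sub>s w\<^sub>s(k)\<^sup>2\<close>. Here \<open>0 \<le> p\<^sub>k \<le> 1\<close> and \<open>\<Sum>\<^sub>k p\<^sub>k \<le> R\<close>, and under these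
  constraints \<open>\<Sum>\<^sub>k \<sigma>\<^sub>k\<^sup>2 p\<^sub>k\<close> is at most the sum of the \<open>R\<close> largest \<open>\<sigma>\<^sub>k\<^sup>2\<close>. The truncated singular
  value decomposition attains the bound.
\<close>


section \<open>Orthonormal systems and Bessel's inequality\<close>

text \<open>A family of \<open>m\<close> pairwise orthogonal vectors of \<open>\<real>\<^sup>n\<close> (functions read on \<open>{..<n}\<close>), each of
  norm \<open>0\<close> or \<open>1\<close>. Allowing zero vectors lets Gram-Schmidt keep the number of vectors, so
  that no dimension count is needed.\<close>

definition orthonormal_or_zero :: "nat \<Rightarrow> nat \<Rightarrow> (nat \<Rightarrow> nat \<Rightarrow> real) \<Rightarrow> bool" where
  "orthonormal_or_zero n m w \<longleftrightarrow>
     (\<forall>s<m. \<forall>t<m. s \<noteq> t \<longrightarrow> (\<Sum>j<n. w s j * w t j) = 0) \<and>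
     (\<forall>s<m. (\<Sum>j<n. w s j * w s j) = 1 \<or> (\<forall>j<n. w s j = 0))"

lemma inner_combination:
  assumes w: "orthonormal_or_zero n m w" and t: "t < m"
  shows "(\<Sum>j<n. (\<Sum>s<m. a s * w s j) * w t j) = a t * (\<Sum>j<n. w t j * w t j)"
proof -
  have "(\<Sum>j<n. (\<Sum>s<m. a s * w s j) * w t j) = (\<Sum>s<m. a s * (\<Sum>j<n. w s j * w t j))"
    unfolding sum_distrib_right sum_distrib_left
    by (subst sum.swap) (simp add: mult.assoc)
  also have "\<dots> = (\<Sum>s<m. if s = t then a t * (\<Sum>j<n. w t j * w t j) else 0)"
    using w t by (intro sum.cong) (auto simp: orthonormal_or_zero_def)
  finally show ?thesis using t by simp
qed

lemma gram_schmidt_exists: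
  "\<exists>w. orthonormal_or_zero n m w \<and>
       (\<forall>r<m. \<exists>a. \<forall>j<n. b r j = (\<Sum>s<m. a s * w s j))"
proof (induction m)
  case 0
  show ?case by (simp add: orthonormal_or_zero_def)
next
  case (Suc m)
  then obtain w where w: "orthonormal_or_zero n m w"
    and span: "\<And>r. r < m \<Longrightarrow> \<exists>a. \<forall>j<n. b r j = (\<Sum>s<m. a s * w s j)" by auto
  define g where "g s = (\<Sum>j<n. b m j * w s j)" for s
  define u where "u j = b m j - (\<Sum>s<m. g s * w s j)" for j
  define N where "N = sqrt (\<Sum>j<n. u j * u j)"
  \<comment> \<open>if \<open>N = 0\<close>, division by zero makes the new vector \<open>0\<close>, as wanted\<close>
  define w' where "w' = w(m := (\<lambda>j. u j / N))"
  have sq: "(\<Sum>j<n. u j * u j) = N * N"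
    unfolding N_def by (simp add: sum_nonneg)
  have N0: "\<forall>j<n. u j = 0" if "N = 0"
    using that sq by (simp add: sum_nonneg_eq_0_iff)
  have u_orth: "(\<Sum>j<n. u j * w t j) = 0" if t: "t < m" for t
  proof -
    have "(\<Sum>j<n. u j * w t j) = g t - g t * (\<Sum>j<n. w t j * w t j)"
      using inner_combination[OF w t, of g]
      by (simp add: u_def left_diff_distrib sum_subtractf g_def)
    also have "\<dots> = 0"
    proof (cases "\<forall>j<n. w t j = 0")
      case True
      then have "g t = 0" by (simp add: g_def)
      then show ?thesis by simp
    next
      case False
      with w t have "(\<Sum>j<n. w t j * w t j) = 1" by (auto simp: orthonormal_or_zero_def)
      then show ?thesis by simp
    qed
    finally show ?thesis .
  qed
  have new: "(\<Sum>j<n. u j / N * w t j) = 0" if "t < m" for t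
    using u_orth[OF that] by (simp add: sum_divide_distrib[symmetric])
  have new': "(\<Sum>j<n. w t j * (u j / N)) = 0" if "t < m" for t
    using new[OF that] by (simp add: mult.commute)
  have unit: "(\<Sum>j<n. u j / N * (u j / N)) = 1" if "N \<noteq> 0"
    using that by (simp add: sum_divide_distrib[symmetric] sq)
  have "orthonormal_or_zero n (Suc m) w'"
    unfolding orthonormal_or_zero_def
  proof (intro conjI allI impI)
    fix s t assume "s < Suc m" "t < Suc m" "s \<noteq> t"
    then show "(\<Sum>j<n. w' s j * w' t j) = 0"
      using w new new' by (auto simp: w'_def less_Suc_eq orthonormal_or_zero_def)
  next
    fix s assume "s < Suc m"
    then show "(\<Sum>j<n. w' s j * w' s j) = 1 \<or> (\<forall>j<n. w' s j = 0)"
      using w unit by (cases "N = 0") (auto simp: w'_def less_Suc_eq orthonormal_or_zero_def)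
  qed
  moreover have "\<exists>a. \<forall>j<n. b r j = (\<Sum>s<Suc m. a s * w' s j)" if r: "r < Suc m" for r
  proof (cases "r = m")
    case True
    have "b m j = (\<Sum>s<m. g s * w s j) + N * (u j / N)" if "j < n" for j
      using N0 that by (cases "N = 0") (auto simp: u_def)
    then show ?thesis
      using True by (intro exI[of _ "g(m := N)"]) (simp add: w'_def)
  next
    case False
    with r span obtain a where "\<forall>j<n. b r j = (\<Sum>s<m. a s * w s j)"
      by (metis less_SucE)
    then show ?thesis
      by (intro exI[of _ "a(m := 0)"]) (simp add: w'_def)
  qed
  ultimately show ?case by blast
qed

text \<open>The distance from \<open>y\<close> to its projection, plus a correction that vanishes exactly when the
  combination is that projection.\<close>

lemma distance_to_combination:
  assumes w: "orthonormal_or_zero n m w"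
  shows "(\<Sum>j<n. (y j - (\<Sum>s<m. a s * w s j))\<^sup>2) =
         (\<Sum>j<n. (y j)\<^sup>2) - (\<Sum>s<m. (\<Sum>j<n. y j * w s j)\<^sup>2)
           + (\<Sum>s<m. ((\<Sum>j<n. y j * w s j) - a s * (\<Sum>j<n. w s j * w s j))\<^sup>2)"
proof -
  let ?g = "\<lambda>s. \<Sum>j<n. y j * w s j" and ?e = "\<lambda>s. \<Sum>j<n. w s j * w s j"
  let ?c = "\<lambda>j. \<Sum>s<m. a s * w s j"
  have yc: "(\<Sum>j<n. y j * ?c j) = (\<Sum>s<m. a s * ?g s)"
    unfolding sum_distrib_left by (subst sum.swap) (simp add: mult.left_commute)
  have "(\<Sum>j<n. ?c j * ?c j) = (\<Sum>s<m. a s * (\<Sum>j<n. ?c j * w s j))"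
    unfolding sum_distrib_left[of "?c _"] sum_distrib_left[of "a _"]
    by (subst sum.swap) (simp add: mult.left_commute)
  also have "\<dots> = (\<Sum>s<m. a s * (a s * ?e s))"
    by (intro sum.cong) (simp_all add: inner_combination[OF w])
  finally have cc: "(\<Sum>j<n. ?c j * ?c j) = (\<Sum>s<m. a s * (a s * ?e s))" .
  have "(\<Sum>j<n. (y j - ?c j)\<^sup>2) = (\<Sum>j<n. (y j)\<^sup>2 - 2 * (y j * ?c j) + ?c j * ?c j)"
    by (intro sum.cong refl) (simp add: power2_eq_square algebra_simps)
  also have "\<dots> = (\<Sum>j<n. (y j)\<^sup>2) - 2 * (\<Sum>s<m. a s * ?g s) + (\<Sum>s<m. a s * (a s * ?e s))"
    by (simp only: sum.distrib sum_subtractf sum_distrib_left[symmetric] yc cc)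
  also have "\<dots> = (\<Sum>j<n. (y j)\<^sup>2) + (\<Sum>s<m. a s * (a s * ?e s) - 2 * (a s * ?g s))"
    by (simp add: sum_subtractf sum_distrib_left)
  also have "(\<Sum>s<m. a s * (a s * ?e s) - 2 * (a s * ?g s)) =
             (\<Sum>s<m. (?g s - a s * ?e s)\<^sup>2 - (?g s)\<^sup>2)"
  proof (intro sum.cong refl)
    fix s assume "s \<in> {..<m}"
    then consider "?e s = 1" | "\<forall>j<n. w s j = 0"
      using w by (auto simp: orthonormal_or_zero_def)
    then show "a s * (a s * ?e s) - 2 * (a s * ?g s) = (?g s - a s * ?e s)\<^sup>2 - (?g s)\<^sup>2"
    proof cases
      case 1
      show ?thesis unfolding 1 by (simp add: power2_eq_square algebra_simps)
    next
      case 2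
      then show ?thesis by simp
    qed
  qed
  finally show ?thesis by (simp add: sum_subtractf)
qed

lemma distance_to_combination_ge:
  assumes "orthonormal_or_zero n m w"
  shows "(\<Sum>j<n. (y j)\<^sup>2) - (\<Sum>s<m. (\<Sum>j<n. y j * w s j)\<^sup>2)
         \<le> (\<Sum>j<n. (y j - (\<Sum>s<m. a s * w s j))\<^sup>2)"
  unfolding distance_to_combination[OF assms] by (simp add: sum_nonneg)

lemma bessel_inequality:
  assumes w: "orthonormal_or_zero n m w"
  shows "(\<Sum>s<m. (\<Sum>j<n. y j * w s j)\<^sup>2) \<le> (\<Sum>j<n. (y j)\<^sup>2)"
proof -
  let ?g = "\<lambda>s. \<Sum>j<n. y j * w s j"
  have "(?g s - ?g s * (\<Sum>j<n. w s j * w s j))\<^sup>2 = 0" if "s < m" for s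
    using w that by (auto simp: orthonormal_or_zero_def)
  then have "(\<Sum>s<m. (?g s - ?g s * (\<Sum>j<n. w s j * w s j))\<^sup>2) = 0"
    by (intro sum.neutral) blast
  then have "(\<Sum>j<n. (y j)\<^sup>2) - (\<Sum>s<m. (?g s)\<^sup>2) = (\<Sum>j<n. (y j - (\<Sum>s<m. ?g s * w s j))\<^sup>2)"
    unfolding distance_to_combination[OF w] by linarith
  also have "\<dots> \<ge> 0" by (simp add: sum_nonneg)
  finally show ?thesis by simp
qed


section \<open>The Eckart-Young theorem in the Frobenius norm\<close>

text \<open>A linear functional with nonnegative, nonincreasing coefficients over the hypersimplex
  \<open>{p \<in> [0,1]\<^sup>n. \<Sum> p \<le> R}\<close> is largest where \<open>p\<close> puts full weight on the first \<open>R\<close> indices.\<close>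

lemma weighted_sum_le_top:
  fixes s p :: "nat \<Rightarrow> real"
  assumes "R \<le> n"
    and s0: "\<And>k. k < n \<Longrightarrow> 0 \<le> s k"
    and dec: "\<And>k l. k \<le> l \<Longrightarrow> l < n \<Longrightarrow> s l \<le> s k"
    and p: "\<And>k. k < n \<Longrightarrow> 0 \<le> p k \<and> p k \<le> 1"
    and sum_p: "(\<Sum>k<n. p k) \<le> real R"
  shows "(\<Sum>k<n. s k * p k) \<le> (\<Sum>k<R. s k)"
proof -
  \<comment> \<open>a threshold separating the first \<open>R\<close> coefficients from the rest\<close>
  define t where "t = (if R < n then s R else 0)"
  have t0: "0 \<le> t" using s0 by (simp add: t_def)
  have "(\<Sum>k<n. (s k - t) * p k) \<le> (\<Sum>k<n. if k < R then s k - t else 0)"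
  proof (rule sum_mono)
    fix k assume "k \<in> {..<n}"
    then have k: "k < n" by simp
    show "(s k - t) * p k \<le> (if k < R then s k - t else 0)"
    proof (cases "k < R")
      case True
      then have "0 \<le> s k - t" using dec[of k R] s0 k by (auto simp: t_def)
      then show ?thesis using True p[OF k] by (simp add: mult_left_le)
    next
      case False
      then have "s k - t \<le> 0" using dec[of R k] k by (auto simp: t_def)
      then show ?thesis using False p[OF k] by (simp add: mult_nonpos_nonneg)
    qed
  qed
  also have "\<dots> = (\<Sum>k<R. s k - t)"
    using \<open>R \<le> n\<close> by (intro sum.mono_neutral_cong_right) auto
  also have "\<dots> = (\<Sum>k<R. s k) - t * real R"
    by (simp add: sum_subtractf)
  finally have "(\<Sum>k<n. s k * p k) \<le> (\<Sum>k<R. s k) - t * real R + t * (\<Sum>k<n. p k)"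
    by (simp add: left_diff_distrib sum_subtractf sum_distrib_left)
  moreover have "t * (\<Sum>k<n. p k) \<le> t * real R"
    using sum_p t0 by (rule mult_left_mono)
  ultimately show ?thesis by linarith
qed

text \<open>The lower bound for a rectangular diagonal matrix; the subtracted sum is the entry of an
  arbitrary matrix of rank at most \<open>R\<close>, written as a sum of \<open>R\<close> outer products.\<close>

lemma eckart_young_diagonal:
  fixes \<sigma> :: "nat \<Rightarrow> real" and b c :: "nat \<Rightarrow> nat \<Rightarrow> real"
  assumes R: "R \<le> min J K"
    and s0: "\<And>k. k < min J K \<Longrightarrow> 0 \<le> \<sigma> k"
    and dec: "\<And>k l. k \<le> l \<Longrightarrow> l < min J K \<Longrightarrow> \<sigma> l \<le> \<sigma> k"
  shows "(\<Sum>k = R..<min J K. (\<sigma> k)\<^sup>2)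
         \<le> (\<Sum>j<J. \<Sum>k<K. ((if j = k then \<sigma> j else 0) - (\<Sum>r<R. b r j * c r k))\<^sup>2)"
proof -
  let ?n = "min J K"
  obtain w where w: "orthonormal_or_zero J R w"
    and "\<forall>r<R. \<exists>a. \<forall>j<J. b r j = (\<Sum>s<R. a s * w s j)"
    using gram_schmidt_exists[of J R b] by blast
  then obtain a where a: "\<And>r j. r < R \<Longrightarrow> j < J \<Longrightarrow> b r j = (\<Sum>s<R. a r s * w s j)"
    by metis
  \<comment> \<open>squared norm of the projection of the \<open>k\<close>-th unit vector to the span of \<open>w\<close>\<close>
  define p where "p k = (\<Sum>s<R. (w s k)\<^sup>2)" for k
  have inner_unit: "(\<Sum>j<J. (if j = k then x else 0) * w s j) = x * w s k"
    if "k < J" for k s x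
    using that by (simp add: if_distrib[of "\<lambda>z. z * _"] cong: if_cong)
  have norm_unit: "(\<Sum>j<J. (if j = k then x else 0)\<^sup>2) = x\<^sup>2" if "k < J" for k and x :: real
    using that by (simp add: if_distrib[of "\<lambda>z. z\<^sup>2"] cong: if_cong)
  have p: "0 \<le> p k \<and> p k \<le> 1" if "k < ?n" for k
    using bessel_inequality[OF w, of "\<lambda>j. if j = k then 1 else 0"] that
    by (simp only: inner_unit norm_unit p_def min_less_iff_conj) (simp add: sum_nonneg)
  have "(\<Sum>k<?n. p k) \<le> (\<Sum>k<J. p k)"
    by (rule sum_mono2) (auto simp: p_def sum_nonneg)
  also have "\<dots> = (\<Sum>s<R. \<Sum>k<J. w s k * w s k)"
    unfolding p_def power2_eq_square by (rule sum.swap)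
  also have "\<dots> \<le> (\<Sum>s<R. 1)"
  proof (rule sum_mono)
    fix s assume "s \<in> {..<R}"
    then have "(\<Sum>k<J. w s k * w s k) = 1 \<or> (\<forall>k<J. w s k = 0)"
      using w by (auto simp: orthonormal_or_zero_def)
    then show "(\<Sum>k<J. w s k * w s k) \<le> 1" by auto
  qed
  finally have sum_p: "(\<Sum>k<?n. p k) \<le> real R" by simp
  have column: "(\<sigma> k)\<^sup>2 * (1 - p k)
      \<le> (\<Sum>j<J. ((if j = k then \<sigma> j else 0) - (\<Sum>r<R. b r j * c r k))\<^sup>2)" if k: "k < ?n" for k
  proof -
    have comb: "(\<Sum>r<R. b r j * c r k) = (\<Sum>s<R. (\<Sum>r<R. a r s * c r k) * w s j)"
      if "j < J" for j
    proof -
      have "(\<Sum>r<R. b r j * c r k) = (\<Sum>r<R. \<Sum>s<R. a r s * w s j * c r k)"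
        using a that by (simp add: sum_distrib_right)
      also have "\<dots> = (\<Sum>s<R. (\<Sum>r<R. a r s * c r k) * w s j)"
        by (subst sum.swap) (simp add: sum_distrib_right mult.assoc mult.commute[of "w _ _"])
      finally show ?thesis .
    qed
    let ?y = "\<lambda>j. if j = k then \<sigma> k else 0"
    have "(\<sigma> k)\<^sup>2 * (1 - p k) = (\<Sum>j<J. (?y j)\<^sup>2) - (\<Sum>s<R. (\<Sum>j<J. ?y j * w s j)\<^sup>2)"
      using k by (simp only: inner_unit norm_unit min_less_iff_conj)
        (simp add: p_def right_diff_distrib power_mult_distrib sum_distrib_left)
    also have "\<dots> \<le> (\<Sum>j<J. (?y j - (\<Sum>s<R. (\<Sum>r<R. a r s * c r k) * w s j))\<^sup>2)"
      by (rule distance_to_combination_ge[OF w])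
    also have "\<dots> = (\<Sum>j<J. ((if j = k then \<sigma> j else 0) - (\<Sum>r<R. b r j * c r k))\<^sup>2)"
      by (intro sum.cong refl) (simp add: comb)
    finally show ?thesis .
  qed
  have "(\<Sum>k<?n. (\<sigma> k)\<^sup>2 * p k) \<le> (\<Sum>k<R. (\<sigma> k)\<^sup>2)"
    using R p sum_p s0 dec
    by (intro weighted_sum_le_top) (auto intro: power_mono)
  moreover have "(\<Sum>k<?n. (\<sigma> k)\<^sup>2) = (\<Sum>k<R. (\<sigma> k)\<^sup>2) + (\<Sum>k = R..<?n. (\<sigma> k)\<^sup>2)"
    using sum.atLeastLessThan_concat[of 0 R ?n "\<lambda>k. (\<sigma> k)\<^sup>2"] R
    by (simp add: atLeast0LessThan)
  ultimately have "(\<Sum>k = R..<?n. (\<sigma> k)\<^sup>2) \<le> (\<Sum>k<?n. (\<sigma> k)\<^sup>2 * (1 - p k))"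
    by (simp add: right_diff_distrib sum_subtractf)
  also have "\<dots> \<le> (\<Sum>k<?n. \<Sum>j<J. ((if j = k then \<sigma> j else 0) - (\<Sum>r<R. b r j * c r k))\<^sup>2)"
    by (intro sum_mono column) simp
  also have "\<dots> \<le> (\<Sum>k<K. \<Sum>j<J. ((if j = k then \<sigma> j else 0) - (\<Sum>r<R. b r j * c r k))\<^sup>2)"
    by (rule sum_mono2) (auto simp: sum_nonneg)
  also have "\<dots> = (\<Sum>j<J. \<Sum>k<K. ((if j = k then \<sigma> j else 0) - (\<Sum>r<R. b r j * c r k))\<^sup>2)"
    by (rule sum.swap)
  finally show ?thesis .
qed

lemma frobenius_norm_sq:
  assumes "A \<in> carrier_mat m n"
  shows "(frobenius_norm A)\<^sup>2 = (\<Sum>j<m. \<Sum>k<n. (A $$ (j, k))\<^sup>2)"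
  using assms by (auto simp: frobenius_norm_def sum_nonneg)

lemma frobenius_norm_transpose: "frobenius_norm A\<^sup>T = frobenius_norm A"
proof -
  have "(\<Sum>j<dim_col A. \<Sum>k<dim_row A. (A\<^sup>T $$ (j, k))\<^sup>2) =
        (\<Sum>j<dim_col A. \<Sum>k<dim_row A. (A $$ (k, j))\<^sup>2)"
    by (intro sum.cong) auto
  then show ?thesis
    unfolding frobenius_norm_def by (subst (2) sum.swap) simp
qed

lemma transpose_mult_self_diag:
  fixes A :: "real mat"
  assumes "A \<in> carrier_mat m n" and "k < n"
  shows "(A\<^sup>T * A) $$ (k, k) = (\<Sum>j<m. (A $$ (j, k))\<^sup>2)"
  using assms by (simp add: scalar_prod_def power2_eq_square atLeast0LessThan)

lemma assoc_mult_mat_dim: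
  assumes "dim_col A = dim_row B" "dim_col B = dim_row C"
  shows "A * B * C = A * (B * (C :: real mat))"
  using assms by (intro assoc_mult_mat) auto

lemma frobenius_norm_orthogonal_left:
  assumes Q: "real_orthogonal m Q" and A: "A \<in> carrier_mat m n"
  shows "frobenius_norm (Q * A) = frobenius_norm A"
proof -
  have Qc: "Q \<in> carrier_mat m m" and QQ: "Q\<^sup>T * Q = 1\<^sub>m m"
    using Q by (auto simp: real_orthogonal_def)
  have QA: "Q * A \<in> carrier_mat m n" using Qc A by simp
  have "(Q * A)\<^sup>T * (Q * A) = A\<^sup>T * (Q\<^sup>T * Q * A)"
    using Qc A by (simp add: transpose_mult[OF Qc A] assoc_mult_mat_dim)
  also have "\<dots> = A\<^sup>T * A" using A by (simp add: QQ)
  finally have gram: "(Q * A)\<^sup>T * (Q * A) = A\<^sup>T * A" .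
  have "(frobenius_norm (Q * A))\<^sup>2 = (frobenius_norm A)\<^sup>2"
    unfolding frobenius_norm_sq[OF QA] frobenius_norm_sq[OF A] sum.swap[of _ "{..<n}" "{..<m}"]
  proof (rule sum.cong[OF refl])
    fix k assume "k \<in> {..<n}"
    then show "(\<Sum>j<m. ((Q * A) $$ (j, k))\<^sup>2) = (\<Sum>j<m. (A $$ (j, k))\<^sup>2)"
      using transpose_mult_self_diag[OF QA, of k] transpose_mult_self_diag[OF A, of k]
      by (simp only: gram lessThan_iff)
  qed
  moreover have "frobenius_norm B \<ge> 0" for B
    by (simp add: frobenius_norm_def sum_nonneg)
  ultimately show ?thesis by (simp add: power2_eq_iff_nonneg)
qed

lemma real_orthogonal_transpose: "real_orthogonal n Q \<Longrightarrow> real_orthogonal n Q\<^sup>T"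
  by (auto simp: real_orthogonal_def)

lemma frobenius_norm_orthogonal_right:
  assumes Q: "real_orthogonal n Q" and A: "A \<in> carrier_mat m n"
  shows "frobenius_norm (A * Q) = frobenius_norm A"
proof -
  have Qc: "Q \<in> carrier_mat n n" using Q by (simp add: real_orthogonal_def)
  have "frobenius_norm (A * Q) = frobenius_norm (Q\<^sup>T * A\<^sup>T)"
    by (metis frobenius_norm_transpose transpose_mult[OF A Qc])
  also have "\<dots> = frobenius_norm A"
    using frobenius_norm_orthogonal_left[OF real_orthogonal_transpose[OF Q], of "A\<^sup>T" m] A
    by (simp add: frobenius_norm_transpose)
  finally show ?thesis .
qed

lemma triple_mult_entry:
  assumes "P \<in> carrier_mat m a" "D \<in> carrier_mat a b" "Q \<in> carrier_mat n b" "j < m" "k < n"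
  shows "(P * D * Q\<^sup>T) $$ (j, k) = (\<Sum>l<b. (\<Sum>i<a. P $$ (j, i) * D $$ (i, l)) * Q $$ (k, l))"
  unfolding sum_distrib_right using assms
  by (subst sum.swap) (simp add: scalar_prod_def atLeast0LessThan assoc_mult_mat_dim
      sum_distrib_left mult.assoc)

lemma mult_diag_mult_entry:
  fixes P Q :: "real mat"
  assumes "P \<in> carrier_mat m a" "Q \<in> carrier_mat n a" "j < m" "k < n"
  shows "(P * mat_diag a d * Q\<^sup>T) $$ (j, k) = (\<Sum>r<a. d r * (P $$ (j, r) * Q $$ (k, r)))"
proof -
  have "(P * mat_diag a d * Q\<^sup>T) $$ (j, k) = (\<Sum>r<a. (P $$ (j, r) * d r) * Q $$ (k, r))"
    unfolding mat_diag_mult_right[OF assms(1)] using assms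
    by (simp add: scalar_prod_def atLeast0LessThan)
  also have "\<dots> = (\<Sum>r<a. d r * (P $$ (j, r) * Q $$ (k, r)))"
    by (intro sum.cong refl) simp
  finally show ?thesis .
qed

lemma khatri_rao_range_eq:
  assumes B: "B \<in> carrier_mat J R" and C: "C \<in> carrier_mat K R"
  shows "khatri_rao_range B C = range (\<lambda>\<mu>. B * mat_diag R \<mu> * C\<^sup>T)"
proof -
  have "mat (dim_row B) (dim_row C)
          (\<lambda>(j, k). \<Sum>r<dim_col B. \<mu> r * outer_product (col B r) (col C r) $$ (j, k))
        = B * mat_diag R \<mu> * C\<^sup>T" for \<mu>
    using B C by (intro eq_matI) (auto simp: mult_diag_mult_entry[OF B C] outer_product_def
        intro!: sum.cong simp del: index_mult_mat(1))
  then show ?thesis by (auto simp: khatri_rao_range_def)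
qed

lemma eckart_young_lower_bound:
  assumes svd: "is_svd J K A Y \<sigma> Z" and R: "R \<le> min J K"
    and B: "B \<in> carrier_mat J R" and C: "C \<in> carrier_mat K R"
    and X: "X \<in> khatri_rao_range B C"
  shows "(\<Sum>k = R..<min J K. (\<sigma> k)\<^sup>2) \<le> (frobenius_norm (A - X))\<^sup>2"
proof -
  define D where "D = mat J K (\<lambda>(j, k). if j = k then \<sigma> j else 0)"
  have Y: "real_orthogonal J Y" and Z: "real_orthogonal K Z" and A: "A = Y * D * Z\<^sup>T"
    and s0: "\<And>k. k < min J K \<Longrightarrow> 0 \<le> \<sigma> k"
    and dec: "\<And>k l. k \<le> l \<Longrightarrow> l < min J K \<Longrightarrow> \<sigma> l \<le> \<sigma> k"
    using svd by (auto simp: is_svd_def D_def)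
  have Yc: "Y \<in> carrier_mat J J" and YY: "Y\<^sup>T * Y = 1\<^sub>m J"
    and Zc: "Z \<in> carrier_mat K K" and ZZ: "Z\<^sup>T * Z = 1\<^sub>m K"
    using Y Z by (auto simp: real_orthogonal_def)
  have Dc: "D \<in> carrier_mat J K" by (simp add: D_def)
  obtain \<mu> where X_eq: "X = B * mat_diag R \<mu> * C\<^sup>T"
    using X by (auto simp: khatri_rao_range_eq[OF B C])
  have dg: "mat_diag R \<mu> \<in> carrier_mat R R" by (simp add: mat_diag_def)
  define E where "E = (Y\<^sup>T * B) * mat_diag R \<mu> * (Z\<^sup>T * C)\<^sup>T"
  have YB: "Y\<^sup>T * B \<in> carrier_mat J R" and ZC: "Z\<^sup>T * C \<in> carrier_mat K R"
    using Yc Zc B C by auto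
  have Xc: "X \<in> carrier_mat J K" using X_eq B C dg by auto
  have Ac: "A \<in> carrier_mat J K" using A Yc Zc Dc by auto
  have E_eq: "E = Y\<^sup>T * X * Z"
  proof -
    have "(Z\<^sup>T * C)\<^sup>T = C\<^sup>T * Z" using transpose_mult[of "Z\<^sup>T" K K C R] Zc C by simp
    then show ?thesis
      unfolding E_def X_eq using Yc Zc B C by (simp add: assoc_mult_mat_dim carrier_matD[OF dg])
  qed
  have D_eq: "D = Y\<^sup>T * A * Z"
  proof -
    have "Y\<^sup>T * A * Z = (Y\<^sup>T * Y) * D * (Z\<^sup>T * Z)"
      unfolding A using Yc Zc Dc
      by (simp add: assoc_mult_mat_dim)
    then show ?thesis using Dc by (simp add: YY ZZ)
  qed
  have "D - E = Y\<^sup>T * (A - X) * Z"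
    unfolding D_eq E_eq using Yc Zc Ac Xc
    by (simp add: mult_minus_distrib_mat[of _ J J _ K] minus_mult_distrib_mat[of _ J K _ _ K])
  then have norm_eq: "frobenius_norm (D - E) = frobenius_norm (A - X)"
    using frobenius_norm_orthogonal_right[OF Z, of "Y\<^sup>T * (A - X)" J]
      frobenius_norm_orthogonal_left[OF real_orthogonal_transpose[OF Y], of "A - X" K]
      Yc minus_carrier_mat[OF Xc, of A]
      mult_carrier_mat[OF transpose_carrier_mat[THEN iffD2, OF Yc] minus_carrier_mat[OF Xc, of A]]
    by (simp only:)
  have Ec: "E \<in> carrier_mat J K" unfolding E_eq using Yc Zc Xc by auto
  have "(\<Sum>k = R..<min J K. (\<sigma> k)\<^sup>2)
        \<le> (\<Sum>j<J. \<Sum>k<K. ((if j = k then \<sigma> j else 0)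
            - (\<Sum>r<R. (\<mu> r * (Y\<^sup>T * B) $$ (j, r)) * (Z\<^sup>T * C) $$ (k, r)))\<^sup>2)"
    by (rule eckart_young_diagonal[OF R s0 dec])
  also have "\<dots> = (\<Sum>j<J. \<Sum>k<K. ((D - E) $$ (j, k))\<^sup>2)"
  proof (intro sum.cong refl)
    fix j k assume "j \<in> {..<J}" "k \<in> {..<K}"
    then have jk: "j < J" "k < K" by auto
    have "E $$ (j, k) = (\<Sum>r<R. (\<mu> r * (Y\<^sup>T * B) $$ (j, r)) * (Z\<^sup>T * C) $$ (k, r))"
      unfolding E_def mult_diag_mult_entry[OF YB ZC jk] by (simp only: mult.assoc)
    then show "((if j = k then \<sigma> j else 0)
            - (\<Sum>r<R. (\<mu> r * (Y\<^sup>T * B) $$ (j, r)) * (Z\<^sup>T * C) $$ (k, r)))\<^sup>2 = ((D - E) $$ (j, k))\<^sup>2"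
      using jk Ec by (simp add: D_def)
  qed
  also have "\<dots> = (frobenius_norm (D - E))\<^sup>2"
    using Dc Ec by (intro frobenius_norm_sq[symmetric]) auto
  finally show ?thesis by (simp only: norm_eq)
qed

lemma first_cols_carrier:
  assumes "A \<in> carrier_mat m n"
  shows "first_cols R A \<in> carrier_mat m R"
  using assms by (auto simp: first_cols_def)

lemma first_cols_entry:
  assumes "A \<in> carrier_mat m n" "R \<le> n" "j < m" "r < R"
  shows "first_cols R A $$ (j, r) = A $$ (j, r)"
  using assms by (auto simp: first_cols_def mat_of_cols_index)

lemma eckart_young_attained:
  assumes svd: "is_svd J K A Y \<sigma> Z" and R: "R \<le> min J K"
  shows "\<exists>X \<in> khatri_rao_range (first_cols R Y) (first_cols R Z).
           (frobenius_norm (A - X))\<^sup>2 = (\<Sum>k = R..<min J K. (\<sigma> k)\<^sup>2)"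
proof -
  define D where "D = mat J K (\<lambda>(j, k). if j = k then \<sigma> j else 0)"
  define E where "E = mat J K (\<lambda>(j, k). if j = k \<and> j < R then \<sigma> j else 0)"
  have Y: "real_orthogonal J Y" and Z: "real_orthogonal K Z" and A: "A = Y * D * Z\<^sup>T"
    using svd by (auto simp: is_svd_def D_def)
  have Yc: "Y \<in> carrier_mat J J" and Zc: "Z \<in> carrier_mat K K"
    using Y Z by (auto simp: real_orthogonal_def)
  have Dc: "D \<in> carrier_mat J K" and Ec: "E \<in> carrier_mat J K" by (simp_all add: D_def E_def)
  note YR = first_cols_carrier[OF Yc, of R] and ZR = first_cols_carrier[OF Zc, of R]
  let ?X = "first_cols R Y * mat_diag R \<sigma> * (first_cols R Z)\<^sup>T"
  have X_eq: "?X = Y * E * Z\<^sup>T"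
  proof (rule eq_matI)
    fix j k assume "j < dim_row (Y * E * Z\<^sup>T)" "k < dim_col (Y * E * Z\<^sup>T)"
    then have jk: "j < J" "k < K" using Yc Zc by auto
    have "(Y * E * Z\<^sup>T) $$ (j, k) = (\<Sum>l<K. (\<Sum>i<J. Y $$ (j, i) * E $$ (i, l)) * Z $$ (k, l))"
      by (rule triple_mult_entry[OF Yc Ec Zc jk])
    also have "\<dots> = (\<Sum>l<K. (if l < R then \<sigma> l * (Y $$ (j, l) * Z $$ (k, l)) else 0))"
    proof (intro sum.cong refl)
      fix l assume "l \<in> {..<K}"
      then have l: "l < K" by simp
      have "(\<Sum>i<J. Y $$ (j, i) * E $$ (i, l)) =
            (\<Sum>i<J. if i = l then (if l < R then Y $$ (j, l) * \<sigma> l else 0) else 0)"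
        using l by (intro sum.cong refl) (auto simp: E_def)
      also have "\<dots> = (if l < R then Y $$ (j, l) * \<sigma> l else 0)"
        using R by simp
      finally show "(\<Sum>i<J. Y $$ (j, i) * E $$ (i, l)) * Z $$ (k, l)
          = (if l < R then \<sigma> l * (Y $$ (j, l) * Z $$ (k, l)) else 0)" by simp
    qed
    also have "\<dots> = (\<Sum>l<R. \<sigma> l * (Y $$ (j, l) * Z $$ (k, l)))"
      using R by (intro sum.mono_neutral_cong_right) auto
    also have "\<dots> = ?X $$ (j, k)"
      unfolding mult_diag_mult_entry[OF YR ZR jk]
      using R jk by (intro sum.cong refl) (simp add: first_cols_entry[OF Yc] first_cols_entry[OF Zc])
    finally show "?X $$ (j, k) = (Y * E * Z\<^sup>T) $$ (j, k)" ..
  qed (use Yc Zc YR ZR in auto)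
  have "A - ?X = Y * (D - E) * Z\<^sup>T"
    unfolding A X_eq using Yc Zc Dc Ec
    by (simp add: mult_minus_distrib_mat[of _ J J _ K] minus_mult_distrib_mat[of _ J K _ _ K])
  then have "frobenius_norm (A - ?X) = frobenius_norm (D - E)"
    using frobenius_norm_orthogonal_right[OF real_orthogonal_transpose[OF Z], of "Y * (D - E)" J]
      frobenius_norm_orthogonal_left[OF Y, of "D - E" K] Yc Dc Ec
      minus_carrier_mat[OF Ec, of D] mult_carrier_mat[OF Yc minus_carrier_mat[OF Ec, of D]]
    by (simp only:)
  then have "(frobenius_norm (A - ?X))\<^sup>2 = (\<Sum>j<J. \<Sum>k<K. ((D - E) $$ (j, k))\<^sup>2)"
    by (simp only: frobenius_norm_sq[OF minus_carrier_mat[OF Ec, of D]])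
  also have "\<dots> = (\<Sum>j<J. \<Sum>k<K. if k = j then (if R \<le> j then (\<sigma> j)\<^sup>2 else 0) else 0)"
    by (intro sum.cong refl) (auto simp: D_def E_def)
  also have "\<dots> = (\<Sum>j<J. if R \<le> j \<and> j < K then (\<sigma> j)\<^sup>2 else 0)"
    by (intro sum.cong refl) simp
  also have "\<dots> = (\<Sum>k = R..<min J K. (\<sigma> k)\<^sup>2)"
    by (intro sum.mono_neutral_cong_right) auto
  finally show ?thesis
    unfolding khatri_rao_range_eq[OF YR ZR] by blast
qed


section \<open>Reduction to the centroid\<close>

text \<open>The column-major index \<open>j + k * J\<close> runs through every position below \<open>J * K\<close> exactly once.\<close>

lemma sum_matricized:
  fixes f :: "nat \<Rightarrow> 'a::comm_monoid_add"
  shows "(\<Sum>j<J. \<Sum>k<K. f (j + k * J)) = (\<Sum>p<J * K. f p)"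
proof -
  have "(\<Sum>p<J * K. f p) = (\<Sum>k<K. \<Sum>p = 0 + k * J..<J + k * J. f p)"
    using sum.nat_group[of f J K] by (simp add: mult.commute add.commute)
  also have "\<dots> = (\<Sum>k<K. \<Sum>j<J. f (j + k * J))"
    by (simp only: sum.shift_bounds_nat_ivl atLeast0LessThan)
  finally show ?thesis by (simp add: sum.swap[of _ "{..<J}"])
qed

lemma frobenius_norm_matricized_col:
  assumes V: "real_orthogonal (J * K) V" and i: "i < J * K"
  shows "(frobenius_norm (matricize J K (col V i)))\<^sup>2 = 1"
proof -
  have Vc: "V \<in> carrier_mat (J * K) (J * K)" and VV: "V\<^sup>T * V = 1\<^sub>m (J * K)"
    using V by (auto simp: real_orthogonal_def)
  have "(frobenius_norm (matricize J K (col V i)))\<^sup>2 = (\<Sum>j<J. \<Sum>k<K. (col V i $ (j + k * J))\<^sup>2)"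
    by (subst frobenius_norm_sq[of _ J K]) (auto simp: matricize_def)
  also have "\<dots> = (\<Sum>p<J * K. (V $$ (p, i))\<^sup>2)"
    using Vc i unfolding sum_matricized[of "\<lambda>p. (col V i $ p)\<^sup>2"] by simp
  also have "\<dots> = (V\<^sup>T * V) $$ (i, i)"
    by (rule transpose_mult_self_diag[OF Vc i, symmetric])
  also have "\<dots> = 1" using i by (simp add: VV)
  finally show ?thesis .
qed

text \<open>The weights are eigenvalues of a Gram matrix, and their sum is the squared Frobenius norm of
  the tensor.\<close>

lemma tensor_gram_weights:
  assumes T: "\<exists>i<I. \<exists>j<J. \<exists>k<K. T i j k \<noteq> 0"
    and V: "real_orthogonal (J * K) V"
    and eig: "tensor_gram I J K T = V * mat_diag (J * K) lam * V\<^sup>T"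
  shows "\<forall>i<J * K. 0 \<le> lam i" and "0 < (\<Sum>i<J * K. lam i)"
proof -
  let ?n = "J * K"
  \<comment> \<open>the unfolding of the tensor along its first mode\<close>
  define G where "G = mat I ?n (\<lambda>(i, p). T i (p mod J) (p div J))"
  have Vc: "V \<in> carrier_mat ?n ?n" and VV: "V\<^sup>T * V = 1\<^sub>m ?n"
    using V by (auto simp: real_orthogonal_def)
  have Gc: "G \<in> carrier_mat I ?n" by (simp add: G_def)
  have dg: "mat_diag ?n lam \<in> carrier_mat ?n ?n" by (simp add: mat_diag_def)
  have GV: "G * V \<in> carrier_mat I ?n" using Gc Vc by simp
  have gram: "tensor_gram I J K T = G\<^sup>T * G"
    by (intro eq_matI)
       (auto simp: tensor_gram_def G_def scalar_prod_def atLeast0LessThan)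
  have "(G * V)\<^sup>T * (G * V) = V\<^sup>T * (G\<^sup>T * G) * V"
    using Gc Vc by (simp add: transpose_mult[OF Gc Vc] assoc_mult_mat_dim)
  also have "\<dots> = V\<^sup>T * V * mat_diag ?n lam * (V\<^sup>T * V)"
    unfolding gram[symmetric] eig using Vc by (simp add: assoc_mult_mat_dim carrier_matD[OF dg])
  also have "\<dots> = mat_diag ?n lam" by (simp add: VV left_mult_one_mat[OF dg] right_mult_one_mat[OF dg])
  finally have lam: "lam i = (\<Sum>a<I. ((G * V) $$ (a, i))\<^sup>2)" if "i < ?n" for i
    using transpose_mult_self_diag[OF GV that] that by (simp add: mat_diag_def)
  show "\<forall>i<?n. 0 \<le> lam i" by (simp add: lam sum_nonneg del: index_mult_mat)
  have "(\<Sum>i<?n. lam i) = (\<Sum>i<?n. \<Sum>a<I. ((G * V) $$ (a, i))\<^sup>2)"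
    using lam by simp
  also have "\<dots> = (frobenius_norm (G * V))\<^sup>2"
    unfolding frobenius_norm_sq[OF GV] by (rule sum.swap)
  also have "\<dots> = (\<Sum>i<I. \<Sum>p<?n. (G $$ (i, p))\<^sup>2)"
    by (simp only: frobenius_norm_orthogonal_right[OF V Gc] frobenius_norm_sq[OF Gc])
  also have "\<dots> > 0"
  proof -
    obtain i j k where ijk: "i < I" "j < J" "k < K" "T i j k \<noteq> 0" using T by blast
    have "j + k * J < J + k * J" using ijk by simp
    also have "\<dots> = Suc k * J" by simp
    also have "\<dots> \<le> K * J" using ijk by (intro mult_le_mono1) simp
    finally have p: "j + k * J < ?n" by (simp add: mult.commute)
    have G_pos: "0 < (G $$ (i, j + k * J))\<^sup>2" using ijk p by (simp add: G_def)
    have "0 < (\<Sum>p<?n. (G $$ (i, p))\<^sup>2)"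
      using p G_pos by (intro sum_pos2[of _ "j + k * J"]) auto
    then show ?thesis
      using ijk by - (rule sum_pos2[of _ i], auto simp: sum_nonneg)
  qed
  finally show "0 < (\<Sum>i<?n. lam i)" .
qed

text \<open>The parallel axis theorem: the weighted spread about \<open>X\<close> is the spread about the centroid plus
  the total weight times the squared distance from \<open>X\<close> to the centroid. Since
  the points have norm \<open>1\<close>, the spread about the centroid depends only on its norm and
  the total weight.\<close>

lemma weighted_loss_eq:
  assumes V: "real_orthogonal (J * K) V"
    and pos: "(\<Sum>i<J * K. lam i) \<noteq> 0"
    and X: "X \<in> carrier_mat J K"
  shows "(\<Sum>i<J * K. lam i * (frobenius_norm (matricize J K (col V i) - X))\<^sup>2) =
         (1 - (frobenius_norm (centroid J K lam V))\<^sup>2) * (\<Sum>i<J * K. lam i)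
         + (\<Sum>i<J * K. lam i) * (frobenius_norm (centroid J K lam V - X))\<^sup>2"
proof -
  let ?n = "J * K"
  let ?L = "\<Sum>i<?n. lam i" and ?A = "centroid J K lam V"
  define W where "W i = matricize J K (col V i)" for i
  have Wc: "W i \<in> carrier_mat J K" for i by (simp add: W_def matricize_def)
  have Ac: "?A \<in> carrier_mat J K" by (simp add: centroid_def)
  have centre: "(\<Sum>i<?n. lam i * W i $$ (j, k)) = ?L * ?A $$ (j, k)" if "j < J" "k < K" for j k
    using that pos by (simp add: centroid_def W_def)
  have diff_sq: "(frobenius_norm (P - X))\<^sup>2 =
      (frobenius_norm P)\<^sup>2 - 2 * (\<Sum>j<J. \<Sum>k<K. P $$ (j, k) * X $$ (j, k)) + (frobenius_norm X)\<^sup>2"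
    if P: "P \<in> carrier_mat J K" for P
  proof -
    have "(frobenius_norm (P - X))\<^sup>2 = (\<Sum>j<J. \<Sum>k<K. (P $$ (j, k))\<^sup>2
        - 2 * (P $$ (j, k) * X $$ (j, k)) + (X $$ (j, k))\<^sup>2)"
      using P X by (subst frobenius_norm_sq[of _ J K])
        (auto intro!: sum.cong simp: power2_eq_square algebra_simps)
    then show ?thesis
      by (simp add: frobenius_norm_sq[OF P] frobenius_norm_sq[OF X] sum.distrib sum_subtractf
          sum_distrib_left)
  qed
  have "(\<Sum>i<?n. lam i * (\<Sum>j<J. \<Sum>k<K. W i $$ (j, k) * X $$ (j, k))) =
        (\<Sum>j<J. \<Sum>k<K. (\<Sum>i<?n. lam i * W i $$ (j, k)) * X $$ (j, k))"
    unfolding sum_distrib_left sum_distrib_right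
    by (simp only: sum.swap[of _ "{..<?n}"] mult.assoc)
  also have "\<dots> = ?L * (\<Sum>j<J. \<Sum>k<K. ?A $$ (j, k) * X $$ (j, k))"
    by (simp add: centre sum_distrib_left mult.assoc)
  finally have cross: "(\<Sum>i<?n. lam i * (\<Sum>j<J. \<Sum>k<K. W i $$ (j, k) * X $$ (j, k))) =
      ?L * (\<Sum>j<J. \<Sum>k<K. ?A $$ (j, k) * X $$ (j, k))" .
  have "(\<Sum>i<?n. lam i * (frobenius_norm (W i - X))\<^sup>2) =
        (\<Sum>i<?n. lam i - 2 * (lam i * (\<Sum>j<J. \<Sum>k<K. W i $$ (j, k) * X $$ (j, k)))
          + lam i * (frobenius_norm X)\<^sup>2)"
  proof (intro sum.cong refl)
    fix i assume "i \<in> {..<?n}"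
    then have "(frobenius_norm (W i))\<^sup>2 = 1"
      using frobenius_norm_matricized_col[OF V] by (simp add: W_def)
    then show "lam i * (frobenius_norm (W i - X))\<^sup>2 =
        lam i - 2 * (lam i * (\<Sum>j<J. \<Sum>k<K. W i $$ (j, k) * X $$ (j, k)))
          + lam i * (frobenius_norm X)\<^sup>2"
      unfolding diff_sq[OF Wc] by (simp add: algebra_simps)
  qed
  also have "\<dots> = ?L - 2 * (?L * (\<Sum>j<J. \<Sum>k<K. ?A $$ (j, k) * X $$ (j, k)))
      + ?L * (frobenius_norm X)\<^sup>2"
    by (simp only: sum.distrib sum_subtractf sum_distrib_left[symmetric]
        sum_distrib_right[symmetric] cross)
  also have "\<dots> = (1 - (frobenius_norm ?A)\<^sup>2) * ?L + ?L * (frobenius_norm (?A - X))\<^sup>2"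
    unfolding diff_sq[OF Ac] by (simp add: algebra_simps)
  finally show ?thesis by (simp only: W_def)
qed

theorem theorem4p3:
  fixes I J K R :: nat
    and T :: "nat \<Rightarrow> nat \<Rightarrow> nat \<Rightarrow> real"
    and V Y Z :: "real mat"
    and lam \<sigma> :: "nat \<Rightarrow> real"
  assumes "0 < I" and "0 < J" and "0 < K"
    and T_nonzero: "\<exists>i<I. \<exists>j<J. \<exists>k<K. T i j k \<noteq> 0"
    and R: "1 \<le> R" "R \<le> min J K"
    and V_orth: "real_orthogonal (J * K) V"
    and eig: "tensor_gram I J K T = V * mat_diag (J * K) lam * V\<^sup>T"
    and svd: "is_svd J K (centroid J K lam V) Y \<sigma> Z"
  shows "is_arg_min (\<lambda>(B, C). kr_loss J K lam V B C)
           (\<lambda>(B, C). B \<in> carrier_mat J R \<and> C \<in> carrier_mat K R)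
           (first_cols R Y, first_cols R Z)
       \<and> (INF (B, C) \<in> carrier_mat J R \<times> carrier_mat K R. kr_loss J K lam V B C) =
           1 / 2 * ((1 - (frobenius_norm (centroid J K lam V))\<^sup>2) * (\<Sum>i<J * K. lam i)
             + (\<Sum>i<J * K. lam i) * (\<Sum>k = R..<min J K. (\<sigma> k)\<^sup>2))"
proof -
  let ?L = "\<Sum>i<J * K. lam i" and ?A = "centroid J K lam V"
  let ?v = "1 / 2 * ((1 - (frobenius_norm ?A)\<^sup>2) * ?L + ?L * (\<Sum>k = R..<min J K. (\<sigma> k)\<^sup>2))"
  let ?f = "\<lambda>X. 1 / 2 * (\<Sum>i<J * K. lam i * (frobenius_norm (matricize J K (col V i) - X))\<^sup>2)"
  let ?S = "carrier_mat J R \<times> carrier_mat K R"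
  have L: "0 < ?L" using tensor_gram_weights(2)[OF T_nonzero V_orth eig] .
  have f_eq: "?f X = 1 / 2 * ((1 - (frobenius_norm ?A)\<^sup>2) * ?L + ?L * (frobenius_norm (?A - X))\<^sup>2)"
    and f_ge: "?v \<le> ?f X"
    if B: "B \<in> carrier_mat J R" and C: "C \<in> carrier_mat K R" and X: "X \<in> khatri_rao_range B C"
    for B C X
  proof -
    have Xc: "X \<in> carrier_mat J K" using X B C by (auto simp: khatri_rao_range_def)
    show f: "?f X = 1 / 2 * ((1 - (frobenius_norm ?A)\<^sup>2) * ?L + ?L * (frobenius_norm (?A - X))\<^sup>2)"
      using weighted_loss_eq[OF V_orth _ Xc] L by simp
    have "?L * (\<Sum>k = R..<min J K. (\<sigma> k)\<^sup>2) \<le> ?L * (frobenius_norm (?A - X))\<^sup>2"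
      using eckart_young_lower_bound[OF svd R(2) B C X] L by (intro mult_left_mono) auto
    then show "?v \<le> ?f X" unfolding f by simp
  qed
  have lower: "?v \<le> kr_loss J K lam V B C"
    if B: "B \<in> carrier_mat J R" and C: "C \<in> carrier_mat K R" for B C
    unfolding kr_loss_def using f_ge[OF B C]
    by (intro cINF_greatest) (auto simp: khatri_rao_range_eq[OF B C])
  have Yc: "Y \<in> carrier_mat J J" and Zc: "Z \<in> carrier_mat K K"
    using svd by (auto simp: is_svd_def real_orthogonal_def)
  note YR = first_cols_carrier[OF Yc, of R] and ZR = first_cols_carrier[OF Zc, of R]
  have opt: "kr_loss J K lam V (first_cols R Y) (first_cols R Z) = ?v"
  proof (rule antisym)
    obtain X where X: "X \<in> khatri_rao_range (first_cols R Y) (first_cols R Z)"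
      and eq: "(frobenius_norm (?A - X))\<^sup>2 = (\<Sum>k = R..<min J K. (\<sigma> k)\<^sup>2)"
      using eckart_young_attained[OF svd R(2)] by blast
    have "bdd_below (?f ` khatri_rao_range (first_cols R Y) (first_cols R Z))"
      using f_ge[OF YR ZR] by (intro bdd_belowI[of _ ?v]) blast
    then have "kr_loss J K lam V (first_cols R Y) (first_cols R Z) \<le> ?f X"
      unfolding kr_loss_def using X by (rule cINF_lower)
    also have "\<dots> = ?v" unfolding f_eq[OF YR ZR X] eq ..
    finally show "kr_loss J K lam V (first_cols R Y) (first_cols R Z) \<le> ?v" .
  qed (rule lower[OF YR ZR])
  have "is_arg_min (\<lambda>(B, C). kr_loss J K lam V B C)
          (\<lambda>(B, C). B \<in> carrier_mat J R \<and> C \<in> carrier_mat K R)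
          (first_cols R Y, first_cols R Z)"
    unfolding is_arg_min_def using YR ZR lower by (auto simp only: opt prod.case not_less not_ex)
      (meson not_less)
  moreover have "(INF (B, C) \<in> ?S. kr_loss J K lam V B C) = ?v"
  proof (rule cInf_eq_minimum)
    show "?v \<in> (\<lambda>(B, C). kr_loss J K lam V B C) ` ?S"
      using YR ZR opt by (intro image_eqI[of _ _ "(first_cols R Y, first_cols R Z)"]) auto
  qed (use lower in auto)
  ultimately show ?thesis ..
qed

end
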